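(* Let $P\subset\mathbb{R}^2$ be a set of $n$ points in convex position. Then algorithm CROSS' applied to $P$ returns a tour of maximum total Euclidean length among all Hamiltonian cycles on $P$.
   Context: Algorithm CROSS', given a finite set $P\subset\mathbb{R}^2$ with $n=|P|$: (1) using a numerical method, find a point $c$ that (approximately) minimizes $c\mapsto\sum_{p\in P}d(c,p)$, $d$ the Euclidean distance; (2) sort $P$ by angular order around $c$, giving $p_1,\dots,p_n$ (indices taken mod $n$); (3) if $n$ is odd, for $i=1,\dots,n$ connect $p_i$ with $p_{i+(n-1)/2}$ and return the resulting tour; (4) if $n$ is even, for $i=1,\dots,n$ connect $p_i$ with $p_{i+n/2-1}$; (5) compute $D=\max_{i=1,\dots,n}\big[d(p_i,p_{i+n/2})+d(p_{i+1},p_{i+1+n/2})-d(p_i,p_{i+n/2+1})-d(p_{i+1},p_{i+n/2})\big]$; (6) perform the 2-exchange attaining this maximum, i.e. replace the edges $\{p_i,p_{i+n/2+1}\}$ and $\{p_{i+1},p_{i+n/2}\}$ by $\{p_i,p_{i+n/2}\}$ and $\{p_{i+1},p_{i+1+n/2}\}$, which increases the length by $D$, and return this tour. Points in convex position are the vertices of a convex polygon.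
   Formalization: The point c found in step (1) is taken to be any point in the interior of the convex hull of P (the minimizer may be a vertex, where angular order is undefined, and an approximate one outside the hull can give a non-optimal tour); n ≥ 3 is assumed. *)

theory Defs
  imports "HOL-Analysis.Analysis"
begin

definition convex_position :: "complex set \<Rightarrow> bool" where
  "convex_position P \<longleftrightarrow> (\<forall>p\<in>P. p \<notin> convex hull (P - {p}))"

definition angularly_sorted :: "complex \<Rightarrow> complex set \<Rightarrow> nat \<Rightarrow> (nat \<Rightarrow> complex) \<Rightarrow> bool" where
  "angularly_sorted c P n p \<longleftrightarrow> bij_betw p {0..<n} P \<and>
     (\<forall>i j. i \<le> j \<longrightarrow> j < n \<longrightarrow> Arg (p i - c) \<le> Arg (p j - c))"

definition pm :: "nat \<Rightarrow> (nat \<Rightarrow> complex) \<Rightarrow> nat \<Rightarrow> complex" where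
  "pm n p k = p (k mod n)"

definition cross_odd :: "nat \<Rightarrow> (nat \<Rightarrow> complex) \<Rightarrow> complex set set" where
  "cross_odd n p = {{pm n p i, pm n p (i + (n - 1) div 2)} | i. i < n}"

definition cross_even_init :: "nat \<Rightarrow> (nat \<Rightarrow> complex) \<Rightarrow> complex set set" where
  "cross_even_init n p = {{pm n p i, pm n p (i + n div 2 - 1)} | i. i < n}"

definition cross_gain :: "nat \<Rightarrow> (nat \<Rightarrow> complex) \<Rightarrow> nat \<Rightarrow> real" where
  "cross_gain n p i =
     dist (pm n p i) (pm n p (i + n div 2)) + dist (pm n p (i + 1)) (pm n p (i + 1 + n div 2))
     - dist (pm n p i) (pm n p (i + n div 2 + 1)) - dist (pm n p (i + 1)) (pm n p (i + n div 2))"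

definition cross_even_exchange :: "nat \<Rightarrow> (nat \<Rightarrow> complex) \<Rightarrow> nat \<Rightarrow> complex set set" where
  "cross_even_exchange n p i =
     (cross_even_init n p - {{pm n p i, pm n p (i + n div 2 + 1)}, {pm n p (i + 1), pm n p (i + n div 2)}})
     \<union> {{pm n p i, pm n p (i + n div 2)}, {pm n p (i + 1), pm n p (i + 1 + n div 2)}}"

text \<open>E is a possible output of steps (3)-(6) of CROSS' for the sorted enumeration p
  (any maximizing index may be chosen in step (6)).\<close>
definition cross'_output :: "nat \<Rightarrow> (nat \<Rightarrow> complex) \<Rightarrow> complex set set \<Rightarrow> bool" where
  "cross'_output n p E \<longleftrightarrow>
     (odd n \<and> E = cross_odd n p) \<or>
     (even n \<and> (\<exists>i<n. cross_gain n p i = (MAX j\<in>{0..<n}. cross_gain n p j)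
                       \<and> E = cross_even_exchange n p i))"

definition tour_edges :: "nat \<Rightarrow> (nat \<Rightarrow> complex) \<Rightarrow> complex set set" where
  "tour_edges n s = {{s i, s ((i + 1) mod n)} | i. i < n}"

definition tour_length :: "nat \<Rightarrow> (nat \<Rightarrow> complex) \<Rightarrow> real" where
  "tour_length n s = (\<Sum>i<n. dist (s i) (s ((i + 1) mod n)))"

end

theory Submission
  imports Defs
begin

text \<open>
  The angular order around an interior point is the cyclic order of the convex polygon, so the
  Euclidean distances satisfy the Kalmanson inequalities, and by a discrete Crofton formula they are
  a nonnegative combination of cut metrics, one for each partition of the cycle into two arcs.
  A Hamiltonian cycle crosses a cut with a side of \<open>k\<close> points at most \<open>2 k\<close> times. For odd \<open>n\<close> the star
  polygon attains this bound on all arc cuts simultaneously. For \<open>n = 2 m\<close> the initial 2-factor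
  attains it on all unbalanced cuts and misses it by exactly \<open>2\<close> on each of the \<open>m\<close> balanced ones. An
  arbitrary tour can be tight on at most one balanced cut, because tightness means that it
  alternates between the two sides, and on the others it misses the bound by at least \<open>2\<close> as well.
  So it exceeds the initial 2-factor by at most twice the largest weight of a balanced cut, and this is
  exactly the maximal gain of the 2-exchange.
\<close>

section \<open>Orientation in the angular order\<close>

definition cross2 :: "complex \<Rightarrow> complex \<Rightarrow> real" where
  "cross2 u v = Re u * Im v - Im u * Re v"

definition orient :: "complex \<Rightarrow> complex \<Rightarrow> complex \<Rightarrow> real" where
  "orient a b c = cross2 (b - a) (c - a)"

lemma cross2_Arg: "cross2 u v = cmod u * cmod v * sin (Arg v - Arg u)"
proof -
  have u: "u = rcis (cmod u) (Arg u)" and v: "v = rcis (cmod v) (Arg v)"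
    by (simp_all add: rcis_cmod_Arg)
  have "Re u = cmod u * cos (Arg u)" "Im u = cmod u * sin (Arg u)"
       "Re v = cmod v * cos (Arg v)" "Im v = cmod v * sin (Arg v)"
    by (metis u Re_rcis, metis u Im_rcis, metis v Re_rcis, metis v Im_rcis)
  then show ?thesis
    unfolding cross2_def by (simp only: sin_diff) (simp add: algebra_simps)
qed

text \<open>A triangle's signed area splits into those of three triangles with apex
  \<open>z\<close>. With \<open>z\<close> the centre, orientation is reduced to angles around
  it.\<close>

lemma orient_eq_cross2_sum:
  "orient a b c = cross2 (a - z) (b - z) + cross2 (b - z) (c - z) + cross2 (c - z) (a - z)"
  by (simp add: orient_def cross2_def algebra_simps)

lemma orient_cycle: "orient a b c = orient b c a"
  by (simp add: orient_def cross2_def algebra_simps)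

text \<open>Cut both diagonals at \<open>x\<close>: each side of the quadrilateral is at most the
  sum of the two pieces at its ends, and two opposite sides use every piece once.\<close>

lemma crossing_segments_dist:
  fixes a b c d x :: "'a::euclidean_space"
  assumes "x \<in> closed_segment a c" "x \<in> closed_segment b d"
  shows "dist a b + dist c d \<le> dist a c + dist b d"
    and "dist a d + dist b c \<le> dist a c + dist b d"
proof -
  have ac: "dist a c = dist a x + dist x c" and bd: "dist b d = dist b x + dist x d"
    using assms unfolding between_mem_segment[symmetric] between by simp_all
  show "dist a b + dist c d \<le> dist a c + dist b d" "dist a d + dist b c \<le> dist a c + dist b d"
    using dist_triangle[of a b x] dist_triangle[of c d x] dist_triangle[of a d x]
      dist_triangle[of b c x] ac bd by (simp_all add: dist_commute)
qed

lemma orient_pos_segments_cross: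
  assumes "orient a b c > 0" "orient a b d > 0" "orient a c d > 0" "orient b c d > 0"
  shows "\<exists>x. x \<in> closed_segment a c \<and> x \<in> closed_segment b d"
proof -
  \<comment> \<open>Twice the area of the quadrilateral; the second form of \<open>s\<close> cuts it
    along the other diagonal.\<close>
  define s where "s = orient b c d + orient a b d"
  have s: "s > 0" "s = orient a c d + orient a b c"
    using assms by (simp_all add: s_def) (simp add: orient_def cross2_def algebra_simps)
  define t where "t = orient a b d / s"
  define r where "r = orient a b c / s"
  have t: "0 \<le> t" "t \<le> 1" "1 - t = orient b c d / s"
    and r: "0 \<le> r" "r \<le> 1" "1 - r = orient a c d / s"
    using s assms by (simp_all add: t_def r_def field_simps) (simp_all add: s_def)
  \<comment> \<open>The affine dependence of four points in the plane has signed triangle areas as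
    coefficients. Divided by \<open>s\<close>, its two sides are the same point on the two
    diagonals.\<close>
  have "orient b c d *\<^sub>R a + orient a b d *\<^sub>R c = orient a c d *\<^sub>R b + orient a b c *\<^sub>R d"
    by (simp add: orient_def cross2_def complex_eq_iff algebra_simps)
  then have "(1 / s) *\<^sub>R (orient b c d *\<^sub>R a + orient a b d *\<^sub>R c)
      = (1 / s) *\<^sub>R (orient a c d *\<^sub>R b + orient a b c *\<^sub>R d)" by simp
  then have "(1 - t) *\<^sub>R a + t *\<^sub>R c = (1 - r) *\<^sub>R b + r *\<^sub>R d"
    unfolding t(3) r(3) by (simp add: scaleR_right_distrib t_def r_def)
  moreover have "(1 - t) *\<^sub>R a + t *\<^sub>R c \<in> closed_segment a c" "(1 - r) *\<^sub>R b + r *\<^sub>R d \<in> closed_segment b d"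
    using t(1,2) r(1,2) unfolding closed_segment_def by blast+
  ultimately show ?thesis by metis
qed

section \<open>Convex position seen from an interior centre\<close>

lemma convex_position_not_interior:
  assumes "finite P" "convex_position P" "x \<in> P"
  shows "x \<notin> interior (convex hull P)"
proof -
  have "x extreme_point_of (convex hull (insert x (P - {x})))"
    using assms by (intro extreme_point_of_convex_hull_insert) (auto simp: convex_position_def)
  moreover have "insert x (P - {x}) = P" using assms by auto
  ultimately show ?thesis using extreme_point_not_in_interior by fastforce
qed

text \<open>If \<open>s + t \<le> 1\<close>, then \<open>b\<close> lies on the segment from
  \<open>c\<close> to a point \<open>y\<close> of the segment \<open>a d\<close>. Either
  \<open>b = y\<close>, a convex combination of other points of \<open>P\<close>, or
  \<open>b\<close> is pulled from \<open>y\<close> towards the interior point \<open>c\<close> and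
  so is interior itself. The case \<open>a = d\<close> is allowed and handles points on one
  ray.\<close>

lemma convex_position_outside_cone:
  assumes P: "finite P" "convex_position P" and c: "c \<in> interior (convex hull P)"
    and abd: "a \<in> P" "b \<in> P" "d \<in> P" "b \<noteq> a" "b \<noteq> d"
    and st: "s \<ge> 0" "t \<ge> 0" "s + t > 0" and eq: "b - c = s *\<^sub>R (a - c) + t *\<^sub>R (d - c)"
  shows "s + t > 1"
proof (rule ccontr)
  assume "\<not> ?thesis"
  then have le: "s + t \<le> 1" by simp
  define y where "y = (s / (s + t)) *\<^sub>R a + (t / (s + t)) *\<^sub>R d"
  have sum1: "s / (s + t) + t / (s + t) = 1" using st by (simp flip: add_divide_distrib)
  have y: "y \<in> convex hull S" if "a \<in> S" "d \<in> S" for S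
    unfolding y_def using that st sum1
    by (intro convexD[OF convex_convex_hull]) (auto intro: hull_inc)
  have "(s + t) *\<^sub>R y = s *\<^sub>R a + t *\<^sub>R d"
    using st by (simp add: y_def scaleR_right_distrib)
  then have b: "b = y - (1 - (s + t)) *\<^sub>R (y - c)"
    using eq by (simp add: algebra_simps)
  show False
  proof (cases "s + t = 1")
    case True
    then have "b \<in> convex hull (P - {b})" using b y[of "P - {b}"] abd by auto
    then show False using P abd by (auto simp: convex_position_def)
  next
    case False
    then have "b \<in> interior (convex hull P)"
      unfolding b using le st c y[of P] abd
      by (intro mem_interior_convex_shrink) auto
    then show False using convex_position_not_interior[OF P abd(2)] by simp
  qed
qed

lemma orient_pos_of_cone:
  assumes P: "finite P" "convex_position P" and c: "c \<in> interior (convex hull P)"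
    and abd: "a \<in> P" "b \<in> P" "d \<in> P" "b \<noteq> a" "b \<noteq> d"
    and pos: "cross2 (a - c) (b - c) > 0" "cross2 (b - c) (d - c) > 0"
    and neg: "cross2 (d - c) (a - c) < 0"
  shows "orient a b d > 0"
proof -
  define u v w where uvw: "u = a - c" "v = b - c" "w = d - c"
  define k where "k = - cross2 w u"
  have k: "k > 0" using neg by (simp add: k_def uvw)
  define s where "s = cross2 v w / k"
  define t where "t = cross2 u v / k"
  \<comment> \<open>Cramer's rule for \<open>v\<close> in the basis \<open>u\<close>,
    \<open>w\<close>.\<close>
  have "k *\<^sub>R v = cross2 v w *\<^sub>R u + cross2 u v *\<^sub>R w"
    by (simp add: k_def cross2_def complex_eq_iff algebra_simps)
  then have "(1 / k) *\<^sub>R (k *\<^sub>R v) = (1 / k) *\<^sub>R (cross2 v w *\<^sub>R u + cross2 u v *\<^sub>R w)" by simp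
  then have "v = s *\<^sub>R u + t *\<^sub>R w" using k by (simp add: scaleR_right_distrib s_def t_def)
  moreover have "s > 0" "t > 0" using pos k by (simp_all add: s_def t_def uvw)
  ultimately have "s + t > 1"
    using convex_position_outside_cone[OF P c abd, of s t] by (simp add: uvw)
  then have "cross2 v w + cross2 u v > k" using k by (simp add: s_def t_def field_simps)
  then show ?thesis by (simp add: orient_eq_cross2_sum[of a b d c] k_def uvw)
qed

text \<open>Sorting alone gives only a weak inequality. Of two points on one ray from
  \<open>c\<close>, each would have to be strictly farther from \<open>c\<close> than the
  other.\<close>

lemma angularly_sorted_Arg_less:
  assumes P: "finite P" "convex_position P" and c: "c \<in> interior (convex hull P)"
    and p: "angularly_sorted c P n p" and ij: "i < j" "j < n"
  shows "Arg (p i - c) < Arg (p j - c)"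
proof (rule ccontr)
  assume "\<not> ?thesis"
  moreover have "Arg (p i - c) \<le> Arg (p j - c)" using p ij by (simp add: angularly_sorted_def)
  ultimately have eq: "Arg (p i - c) = Arg (p j - c)" by simp
  have bij: "bij_betw p {0..<n} P" using p by (simp add: angularly_sorted_def)
  have inP: "p i \<in> P" "p j \<in> P" using bij ij by (auto dest: bij_betwE)
  have ne: "p i \<noteq> p j" using bij ij by (auto simp: bij_betw_def dest: inj_onD)
  have nc: "p i \<noteq> c" "p j \<noteq> c" using inP convex_position_not_interior[OF P] c by auto
  define r where "r = cmod (p i - c) / cmod (p j - c)"
  have r: "r > 0" using nc by (simp add: r_def)
  have pij: "p i - c = rcis (cmod (p i - c)) (Arg (p i - c))"
    "p j - c = rcis (cmod (p j - c)) (Arg (p i - c))"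
    by (simp add: rcis_cmod_Arg, simp add: eq rcis_cmod_Arg)
  have e1: "p i - c = r *\<^sub>R (p j - c)"
    using nc by (subst pij(1), subst pij(2)) (simp add: rcis_def r_def scaleR_conv_of_real)
  then have e2: "p j - c = (1 / r) *\<^sub>R (p i - c)" using r by simp
  have "r > 1"
    using convex_position_outside_cone[OF P c inP(2,1,2) ne ne, of r 0] e1 r by simp
  moreover have "1 / r > 1"
    using convex_position_outside_cone[OF P c inP(1,2,1) ne[symmetric] ne[symmetric], of "1/r" 0] e2 r
    by simp
  ultimately show False by simp
qed

text \<open>The angles \<open>\<alpha>\<close>, \<open>\<beta>\<close> and
  \<open>2 * pi - \<alpha> - \<beta>\<close> between consecutive rays are positive and sum to a full
  turn. If one exceeds \<open>pi\<close>, the third point lies in the cone of the other two, and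
  \<open>orient_pos_of_cone\<close> applies after a cyclic rotation. Otherwise the three signed
  areas at \<open>c\<close> are nonnegative and not all zero.\<close>

lemma angularly_sorted_orient_pos:
  assumes P: "finite P" "convex_position P" and c: "c \<in> interior (convex hull P)"
    and p: "angularly_sorted c P n p" and ijk: "i < j" "j < k" "k < n"
  shows "orient (p i) (p j) (p k) > 0"
proof -
  define u v w where uvw: "u = p i - c" "v = p j - c" "w = p k - c"
  have bij: "bij_betw p {0..<n} P" using p by (simp add: angularly_sorted_def)
  have inP: "p i \<in> P" "p j \<in> P" "p k \<in> P" using bij ijk by (auto dest: bij_betwE)
  have ne: "p i \<noteq> p j" "p j \<noteq> p k" "p k \<noteq> p i"
    using bij ijk by (auto simp: bij_betw_def dest: inj_onD)
  have nz: "cmod u > 0" "cmod v > 0" "cmod w > 0"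
    using inP convex_position_not_interior[OF P] c by (auto simp: uvw)
  define \<alpha> where "\<alpha> = Arg v - Arg u"
  define \<beta> where "\<beta> = Arg w - Arg v"
  have ab: "\<alpha> > 0" "\<beta> > 0"
    using angularly_sorted_Arg_less[OF P c p] ijk by (simp_all add: \<alpha>_def \<beta>_def uvw)
  have ab2: "\<alpha> + \<beta> < 2 * pi"
    using Arg_le_pi[of w] mpi_less_Arg[of u] by (simp add: \<alpha>_def \<beta>_def)
  have cr: "cross2 u v = cmod u * cmod v * sin \<alpha>" "cross2 v w = cmod v * cmod w * sin \<beta>"
    "cross2 w u = - (cmod w * cmod u * sin (\<alpha> + \<beta>))"
    using sin_minus[of "Arg w - Arg u"] by (simp_all add: cross2_Arg \<alpha>_def \<beta>_def)
  have sgn_sin: "sin x > 0 \<longleftrightarrow> x < pi" "sin x < 0 \<longleftrightarrow> x > pi" "sin x = 0 \<longleftrightarrow> x = pi"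
    if "0 < x" "x < 2 * pi" for x
  proof -
    have "sin x > 0" if "x < pi" using that \<open>0 < x\<close> sin_gt_zero by simp
    moreover have "sin x < 0" if "x > pi" using that \<open>x < 2 * pi\<close> sin_lt_zero by simp
    ultimately show "sin x > 0 \<longleftrightarrow> x < pi" "sin x < 0 \<longleftrightarrow> x > pi" "sin x = 0 \<longleftrightarrow> x = pi"
      by (cases x pi rule: linorder_cases; fastforce)+
  qed
  have c1: "cross2 u v > 0 \<longleftrightarrow> \<alpha> < pi" "cross2 u v < 0 \<longleftrightarrow> \<alpha> > pi"
    using nz ab ab2 sgn_sin[of \<alpha>] by (simp_all add: cr zero_less_mult_iff mult_less_0_iff)
  have c2: "cross2 v w > 0 \<longleftrightarrow> \<beta> < pi" "cross2 v w < 0 \<longleftrightarrow> \<beta> > pi"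
    using nz ab ab2 sgn_sin[of \<beta>] by (simp_all add: cr zero_less_mult_iff mult_less_0_iff)
  have c3: "cross2 w u > 0 \<longleftrightarrow> \<alpha> + \<beta> > pi" "cross2 w u < 0 \<longleftrightarrow> \<alpha> + \<beta> < pi"
    using nz ab ab2 sgn_sin[of "\<alpha> + \<beta>"] by (simp_all add: cr zero_less_mult_iff mult_less_0_iff)
  have cyc: "orient (p i) (p j) (p k) = orient (p j) (p k) (p i)"
    "orient (p i) (p j) (p k) = orient (p k) (p i) (p j)"
    by (metis orient_cycle)+
  consider "cross2 u v < 0" | "cross2 v w < 0" | "cross2 w u < 0"
    | "cross2 u v \<ge> 0" "cross2 v w \<ge> 0" "cross2 w u \<ge> 0" by linarith
  then show ?thesis
  proof cases
    case 1
    then show ?thesis using c1 c2 c3 ab ab2 inP ne unfolding cyc(1)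
      by (intro orient_pos_of_cone[OF P c]) (auto simp: uvw)
  next
    case 2
    then show ?thesis using c1 c2 c3 ab ab2 inP ne unfolding cyc(2)
      by (intro orient_pos_of_cone[OF P c]) (auto simp: uvw)
  next
    case 3
    then show ?thesis using c1 c2 c3 ab ab2 inP ne
      by (intro orient_pos_of_cone[OF P c]) (auto simp: uvw)
  next
    case 4
    then have "cross2 u v + cross2 v w + cross2 w u > 0"
      using c1 c2 c3 ab ab2 by (smt (verit))
    then show ?thesis by (simp add: orient_eq_cross2_sum[of _ _ _ c] uvw)
  qed
qed

section \<open>Cut decomposition of a cyclic metric\<close>

text \<open>For nonadjacent edges of the cycle, this is the excess of the diagonals of the
  quadrilateral \<open>a, a + 1, b, b + 1\<close> over two opposite sides. For \<open>b\<close> half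
  a turn from \<open>a\<close> it is \<open>cross_gain\<close>.\<close>

definition mixed_diff :: "(nat \<Rightarrow> nat \<Rightarrow> real) \<Rightarrow> nat \<Rightarrow> nat \<Rightarrow> real" where
  "mixed_diff D a b = D a b + D (Suc a) (Suc b) - D a (Suc b) - D (Suc a) b"

text \<open>The two sides of the cut that separates \<open>a\<close> from \<open>a + 1\<close> and \<open>b\<close> from \<open>b + 1\<close> on the cycle.\<close>
definition arc_cut :: "nat \<Rightarrow> nat \<Rightarrow> nat \<Rightarrow> bool" where
  "arc_cut a b i \<longleftrightarrow> (a < i) \<noteq> (b < i)"

text \<open>Edges come as two endpoint sequences, so that a tour and the 2-factor of a cyclic shift
  are treated alike.\<close>

definition crossings :: "nat \<Rightarrow> ('a \<Rightarrow> bool) \<Rightarrow> (nat \<Rightarrow> 'a) \<Rightarrow> (nat \<Rightarrow> 'a) \<Rightarrow> real" where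
  "crossings n c f g = (\<Sum>k<n. of_bool (c (f k) \<noteq> c (g k)))"

lemma arc_cut_commute: "arc_cut a b = arc_cut b a"
  by (auto simp: arc_cut_def)

text \<open>Telescoping in both variables leaves the four corners.\<close>

lemma sum_mixed_diff_rectangle:
  assumes "i \<le> j" "k \<le> l"
  shows "(\<Sum>a\<in>{i..<j}. \<Sum>b\<in>{k..<l}. mixed_diff D a b) = D i k + D j l - D i l - D j k"
proof -
  have inner: "(\<Sum>b\<in>{k..<l}. mixed_diff D a b) = (D (Suc a) l - D a l) - (D (Suc a) k - D a k)" for a
    using sum_Suc_diff'[OF assms(2), of "\<lambda>b. D (Suc a) b - D a b"]
    by (simp add: mixed_diff_def algebra_simps)
  show ?thesis
    unfolding inner using sum_Suc_diff'[OF assms(1), of "\<lambda>a. D a l - D a k"]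
    by (simp add: algebra_simps)
qed

text \<open>For a Kalmanson metric the \<open>mixed_diff\<close> are nonnegative off the diagonal, so this writes the
  metric as a nonnegative combination of cut metrics of arcs; each cut is counted twice.\<close>
lemma discrete_Crofton:
  assumes sym: "\<And>x y. D x y = D y x" and refl: "\<And>x. D x x = 0"
    and per: "\<And>x. D x n = D x 0" and ij: "i < n" "j < n"
  shows "4 * D i j = (\<Sum>a<n. \<Sum>b<n. mixed_diff D a b * of_bool (arc_cut a b i \<noteq> arc_cut a b j))"
proof -
  have main: "4 * D i j = (\<Sum>a<n. \<Sum>b<n. mixed_diff D a b * of_bool (arc_cut a b i \<noteq> arc_cut a b j))"
    if ij: "i \<le> j" "j < n" for i j
  proof -
    define A where "A = {i..<j}"
    define B where "B = {..<n} - A"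
    have AB: "{..<n} = A \<union> B" "A \<inter> B = {}" "finite A" "finite B" "B = {0..<i} \<union> {j..<n}"
      using ij by (auto simp: A_def B_def)
    \<comment> \<open>The cut separates \<open>i\<close> from \<open>j\<close> exactly when one of
      \<open>a\<close>, \<open>b\<close> lies in \<open>A\<close> and the other does not.\<close>
    have of_cut: "of_bool (arc_cut a b i \<noteq> arc_cut a b j) = (of_bool ((a \<in> A) \<noteq> (b \<in> A)) :: real)" for a b
      using ij by (auto simp: A_def arc_cut_def)
    have md_sym: "mixed_diff D a b = mixed_diff D b a" for a b
      using sym by (simp add: mixed_diff_def)
    have "(\<Sum>a\<in>A. \<Sum>b\<in>B. mixed_diff D a b)
        = (\<Sum>a\<in>A. (\<Sum>b\<in>{0..<i}. mixed_diff D a b) + (\<Sum>b\<in>{j..<n}. mixed_diff D a b))"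
      unfolding AB(5) using ij by (intro sum.cong refl sum.union_disjoint) auto
    \<comment> \<open>Each of the two rectangles contributes one \<open>D i j\<close>. The corners
      at \<open>0\<close> cancel those at \<open>n\<close> by periodicity, and the diagonal corners
      vanish.\<close>
    also have "\<dots> = 2 * D i j"
      using ij unfolding A_def sum.distrib
      by (simp add: sum_mixed_diff_rectangle refl per sym)
    finally have rect: "(\<Sum>a\<in>A. \<Sum>b\<in>B. mixed_diff D a b) = 2 * D i j" .
    have "(\<Sum>a<n. \<Sum>b<n. mixed_diff D a b * of_bool (arc_cut a b i \<noteq> arc_cut a b j))
        = (\<Sum>a\<in>A. \<Sum>b\<in>B. mixed_diff D a b) + (\<Sum>a\<in>B. \<Sum>b\<in>A. mixed_diff D a b)"
    proof -
      have "(\<Sum>b<n. mixed_diff D a b * of_bool (arc_cut a b i \<noteq> arc_cut a b j))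
          = (\<Sum>b\<in>B. mixed_diff D a b)" if "a \<in> A" for a
        unfolding AB(1) sum.union_disjoint[OF AB(3,4,2)] of_cut
        using that AB(2) by (auto intro!: sum.cong simp: disjoint_iff)
      moreover have "(\<Sum>b<n. mixed_diff D a b * of_bool (arc_cut a b i \<noteq> arc_cut a b j))
          = (\<Sum>b\<in>A. mixed_diff D a b)" if "a \<in> B" for a
        unfolding AB(1) sum.union_disjoint[OF AB(3,4,2)] of_cut
        using that AB(2) by (auto intro!: sum.cong sum.neutral simp: disjoint_iff)
      ultimately show ?thesis
        by (subst AB(1), subst sum.union_disjoint[OF AB(3,4,2)]) simp
    qed
    also have "(\<Sum>a\<in>B. \<Sum>b\<in>A. mixed_diff D a b) = (\<Sum>a\<in>A. \<Sum>b\<in>B. mixed_diff D a b)"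
      by (subst sum.swap) (simp add: md_sym)
    finally show ?thesis using rect by simp
  qed
  show ?thesis
  proof (cases "i \<le> j")
    case True
    then show ?thesis using main ij by blast
  next
    case False
    then have "4 * D j i = (\<Sum>a<n. \<Sum>b<n. mixed_diff D a b * of_bool (arc_cut a b j \<noteq> arc_cut a b i))"
      using main ij by simp
    then show ?thesis by (simp add: sym[of i j] eq_commute)
  qed
qed

lemma discrete_Crofton_sum:
  assumes "\<And>x y. D x y = D y x" "\<And>x. D x x = 0" "\<And>x. D x n = D x 0"
    and "\<And>k. k < N \<Longrightarrow> f k < n" "\<And>k. k < N \<Longrightarrow> g k < n"
  shows "4 * (\<Sum>k<N. D (f k) (g k)) = (\<Sum>a<n. \<Sum>b<n. mixed_diff D a b * crossings N (arc_cut a b) f g)"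
proof -
  have "4 * (\<Sum>k<N. D (f k) (g k))
      = (\<Sum>k<N. \<Sum>a<n. \<Sum>b<n. mixed_diff D a b * of_bool (arc_cut a b (f k) \<noteq> arc_cut a b (g k)))"
    unfolding sum_distrib_left
    by (intro sum.cong refl discrete_Crofton) (use assms in auto)
  also have "\<dots> = (\<Sum>a<n. \<Sum>k<N. \<Sum>b<n. mixed_diff D a b * of_bool (arc_cut a b (f k) \<noteq> arc_cut a b (g k)))"
    by (rule sum.swap)
  also have "\<dots> = (\<Sum>a<n. \<Sum>b<n. \<Sum>k<N. mixed_diff D a b * of_bool (arc_cut a b (f k) \<noteq> arc_cut a b (g k)))"
    by (intro sum.cong refl sum.swap)
  finally show ?thesis unfolding crossings_def sum_distrib_left .
qed

text \<open>Count edge ends on the side \<open>c\<close>: every vertex there is an end once in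
  \<open>f\<close> and once in \<open>g\<close>, and an edge inside the side uses up two ends
  without crossing. So the bound is attained exactly when no edge lies inside that side.\<close>

lemma crossings_eq:
  assumes f: "bij_betw f {..<n} V" and g: "bij_betw g {..<n} V"
  shows "crossings n c f g = 2 * real (card {x\<in>V. c x}) - 2 * real (card {k. k < n \<and> c (f k) \<and> c (g k)})"
proof -
  have fin: "finite V" using f by (simp add: bij_betw_finite[symmetric])
  have count: "(\<Sum>k<n. of_bool (c (h k))) = real (card {x\<in>V. c x})" if "bij_betw h {..<n} V" for h
    using sum.reindex_bij_betw[OF that, of "\<lambda>x. of_bool (c x) :: real"] fin
    by (simp add: sum_of_bool_eq Int_def)
  have both: "(\<Sum>k<n. of_bool (c (f k) \<and> c (g k))) = real (card {k. k < n \<and> c (f k) \<and> c (g k)})"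
    by (simp only: sum_of_bool_eq finite_lessThan) (simp add: Int_def)
  have "of_bool (c (f k) \<noteq> c (g k)) = of_bool (c (f k)) + of_bool (c (g k)) - 2 * (of_bool (c (f k) \<and> c (g k)) :: real)" for k
    by auto
  then have "crossings n c f g = (\<Sum>k<n. of_bool (c (f k))) + (\<Sum>k<n. of_bool (c (g k)))
      - 2 * (\<Sum>k<n. of_bool (c (f k) \<and> c (g k)))"
    by (simp add: crossings_def sum.distrib sum_subtractf sum_distrib_left del: of_bool_conj)
  then show ?thesis using count[OF f] count[OF g] both by simp
qed

lemma crossings_compl: "crossings n (\<lambda>x. \<not> c x) f g = crossings n c f g"
  by (simp add: crossings_def)

lemma crossings_le_of_independent:
  assumes "bij_betw f {..<n} V" "bij_betw g {..<n} V" "bij_betw f' {..<n} V" "bij_betw g' {..<n} V"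
    and "\<And>k. k < n \<Longrightarrow> \<not> (c (f' k) \<and> c (g' k))"
  shows "crossings n c f g \<le> crossings n c f' g'"
proof -
  have "{k. k < n \<and> c (f' k) \<and> c (g' k)} = {}" using assms(5) by blast
  then show ?thesis
    unfolding crossings_eq[OF assms(1,2), of c] crossings_eq[OF assms(3,4), of c] by (simp only: card.empty)
qed

section \<open>Cyclic shifts and arc cuts\<close>

lemma bij_betw_add_mod: "bij_betw (\<lambda>x. (x + h) mod n) {..<n} {..<n::nat}"
proof (cases "n = 0")
  case False
  have "inj_on (\<lambda>x. (x + h) mod n) {..<n}"
  proof (rule inj_onI)
    fix x y assume "x \<in> {..<n}" "y \<in> {..<n}" "(x + h) mod n = (y + h) mod n"
    then have "int n dvd int x - int y"
      by (metis add_diff_cancel_right mod_eq_dvd_iff of_nat_add of_nat_mod)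
    then show "x = y" using \<open>x \<in> {..<n}\<close> \<open>y \<in> {..<n}\<close> zdvd_imp_le[of "int n" "\<bar>int x - int y\<bar>"]
      by force
  qed
  moreover have "(\<lambda>x. (x + h) mod n) ` {..<n} \<subseteq> {..<n}" using False by auto
  ultimately show ?thesis by (simp add: bij_betw_def endo_inj_surj)
qed (simp add: bij_betw_def)

lemma mod_less_double: "(x::nat) mod n = (if x < n then x else x - n)" if "x < 2 * n"
  using that by (auto simp: mod_if)

text \<open>This side is the arc \<open>{a<..b}\<close>, where indices differ by less than
  \<open>b - a\<close>, while the shift changes an index by \<open>h\<close> or, after wrapping, by
  \<open>n - h\<close>.\<close>

lemma arc_cut_independent_small:
  assumes "a \<le> b" "b < n" "b - a \<le> h" "b - a \<le> n - h" "x < n" "h < n"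
  shows "\<not> (arc_cut a b x \<and> arc_cut a b ((x + h) mod n))"
  using assms by (auto simp: arc_cut_def mod_less_double split: if_splits)

lemma arc_cut_independent_large:
  assumes "a \<le> b" "b < n" "n - (b - a) \<le> h" "n - (b - a) \<le> n - h" "x < n" "h < n"
  shows "\<not> (\<not> arc_cut a b x \<and> \<not> arc_cut a b ((x + h) mod n))"
  using assms by (auto simp: arc_cut_def mod_less_double split: if_splits)

text \<open>A side with at most \<open>min h (n - h)\<close> points contains no edge of the shift.
  For \<open>n = 2 * h + 1\<close> every arc cut has such a side; for \<open>n = 2 * m\<close> and
  \<open>h = m - 1\<close> every unbalanced one does.\<close>

lemma crossings_le_shift:
  assumes "bij_betw f {..<n} {..<n}" "bij_betw g {..<n} {..<n}" and ab: "a < n" "b < n" and h: "h < n"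
    and disj: "max a b - min a b \<le> min h (n - h) \<or> n - (max a b - min a b) \<le> min h (n - h)"
  shows "crossings n (arc_cut a b) f g \<le> crossings n (arc_cut a b) (\<lambda>x. x) (\<lambda>x. (x + h) mod n)"
proof -
  have *: "crossings n (arc_cut a b) f g \<le> crossings n (arc_cut a b) (\<lambda>x. x) (\<lambda>x. (x + h) mod n)"
    if "a \<le> b" "b < n" and disj: "b - a \<le> min h (n - h) \<or> n - (b - a) \<le> min h (n - h)" for a b
    using disj
  proof
    assume "b - a \<le> min h (n - h)"
    then show ?thesis using that h assms(1,2)
      by (intro crossings_le_of_independent[of f n "{..<n}"] bij_betw_add_mod bij_betw_id[unfolded id_def]
          arc_cut_independent_small) auto
  next
    assume "n - (b - a) \<le> min h (n - h)"
    then have "crossings n (\<lambda>x. \<not> arc_cut a b x) f g \<le> crossings n (\<lambda>x. \<not> arc_cut a b x) (\<lambda>x. x) (\<lambda>x. (x + h) mod n)"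
      using that h assms(1,2)
      by (intro crossings_le_of_independent[of f n "{..<n}"] bij_betw_add_mod bij_betw_id[unfolded id_def]
          arc_cut_independent_large) auto
    then show ?thesis by (simp only: crossings_compl)
  qed
  show ?thesis
    using *[of a b] *[of b a] ab disj by (cases "a \<le> b") (auto simp: arc_cut_commute[of a b])
qed

text \<open>The Kalmanson inequality: the diagonals of a convex quadrilateral cross, so they are
  together at least as long as two opposite sides.\<close>

lemma mixed_diff_dist_nonneg:
  assumes P: "finite P" "convex_position P" and c: "c \<in> interior (convex hull P)"
    and p: "angularly_sorted c P n p" and ab: "a < n" "b < n" "a \<noteq> b"
  shows "0 \<le> mixed_diff (\<lambda>x y. dist (pm n p x) (pm n p y)) a b"
proof -
  let ?D = "\<lambda>x y. dist (pm n p x) (pm n p y)"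
  note orient = angularly_sorted_orient_pos[OF P c p]
  have quad: "dist (p i) (p j) + dist (p k) (p l) \<le> dist (p i) (p k) + dist (p j) (p l)"
    "dist (p i) (p l) + dist (p j) (p k) \<le> dist (p i) (p k) + dist (p j) (p l)"
    if ijkl: "i < j" "j < k" "k < l" "l < n" for i j k l
  proof -
    have "orient (p i) (p j) (p k) > 0" "orient (p i) (p j) (p l) > 0"
      "orient (p i) (p k) (p l) > 0" "orient (p j) (p k) (p l) > 0"
      using ijkl by (auto intro!: orient)
    from orient_pos_segments_cross[OF this]
    obtain x where "x \<in> closed_segment (p i) (p k)" "x \<in> closed_segment (p j) (p l)" by blast
    then show "dist (p i) (p j) + dist (p k) (p l) \<le> dist (p i) (p k) + dist (p j) (p l)"
      "dist (p i) (p l) + dist (p j) (p k) \<le> dist (p i) (p k) + dist (p j) (p l)"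
      by (rule crossing_segments_dist)+
  qed
  have main: "0 \<le> mixed_diff ?D a b" if ab: "a < b" "b < n" for a b
  proof -
    have pm: "pm n p a = p a" "pm n p b = p b" "pm n p (Suc a) = p (Suc a)"
      using ab by (simp_all add: pm_def)
    \<comment> \<open>In the first two cases the edges share a vertex and the triangle inequality
      suffices. In the last case \<open>Suc b\<close> wraps around to \<open>0\<close>, which
      changes the order of the four points.\<close>
    consider "b = Suc a" | "Suc b = n" "a = 0" | "Suc a < b" "Suc b < n"
      | "Suc a < b" "Suc b = n" "0 < a" using ab by linarith
    then show ?thesis
    proof cases
      case 1
      then show ?thesis using dist_triangle by (simp add: mixed_diff_def)
    next
      case 2
      then have "pm n p (Suc b) = p a" by (simp add: pm_def)
      then show ?thesis unfolding mixed_diff_def pm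
        using dist_triangle[of "p (Suc a)" "p b" "p a"] by simp
    next
      case 3
      then have "pm n p (Suc b) = p (Suc b)" by (simp add: pm_def)
      then show ?thesis unfolding mixed_diff_def pm
        using quad(2)[of a "Suc a" b "Suc b"] 3 by simp
    next
      case 4
      then have "pm n p (Suc b) = p 0" by (simp add: pm_def)
      then show ?thesis unfolding mixed_diff_def pm
        using quad(1)[of 0 a "Suc a" b] 4 ab by (simp add: dist_commute)
    qed
  qed
  show ?thesis
  proof (cases "a < b")
    case True
    then show ?thesis using main ab by simp
  next
    case False
    then have "0 \<le> mixed_diff ?D b a" using main ab by simp
    then show ?thesis by (simp add: mixed_diff_def dist_commute)
  qed
qed

section \<open>Upper bounds for tours\<close>

lemma bij_betw_Suc_mod: "bij_betw (\<lambda>k. Suc k mod n) {..<n} {..<n}"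
  using bij_betw_add_mod[of 1 n] by simp

lemma odd_tour_bound:
  assumes D: "\<And>x y. D x y = D y x" "\<And>x. D x x = 0" "\<And>x. D x n = D x 0"
    and pos: "\<And>a b. a < n \<Longrightarrow> b < n \<Longrightarrow> a \<noteq> b \<Longrightarrow> 0 \<le> mixed_diff D a b"
    and n: "n = 2 * h + 1" and bij: "bij_betw \<pi> {..<n} {..<n}"
  shows "(\<Sum>k<n. D (\<pi> k) (\<pi> (Suc k mod n))) \<le> (\<Sum>x<n. D x ((x + h) mod n))"
proof -
  have bij': "bij_betw (\<lambda>k. \<pi> (Suc k mod n)) {..<n} {..<n}"
    using bij_betw_trans[OF bij_betw_Suc_mod bij] by (simp add: o_def)
  have "4 * (\<Sum>k<n. D (\<pi> k) (\<pi> (Suc k mod n)))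
      = (\<Sum>a<n. \<Sum>b<n. mixed_diff D a b * crossings n (arc_cut a b) \<pi> (\<lambda>k. \<pi> (Suc k mod n)))"
    using bij bij' by (intro discrete_Crofton_sum D) (auto dest: bij_betwE)
  also have "\<dots> \<le> (\<Sum>a<n. \<Sum>b<n. mixed_diff D a b * crossings n (arc_cut a b) (\<lambda>x. x) (\<lambda>x. (x + h) mod n))"
  proof (intro sum_mono)
    fix a b assume ab: "a \<in> {..<n}" "b \<in> {..<n}"
    show "mixed_diff D a b * crossings n (arc_cut a b) \<pi> (\<lambda>k. \<pi> (Suc k mod n))
      \<le> mixed_diff D a b * crossings n (arc_cut a b) (\<lambda>x. x) (\<lambda>x. (x + h) mod n)"
    \<comment> \<open>A diagonal weight may be negative, but the cut with \<open>a = b\<close> has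
      an empty side and is never crossed.\<close>
    proof (cases "a = b")
      case True
      then show ?thesis by (simp add: crossings_def arc_cut_def)
    next
      case False
      then show ?thesis
        using ab n by (intro mult_left_mono crossings_le_shift bij bij' pos) auto
    qed
  qed
  also have "\<dots> = 4 * (\<Sum>x<n. D x ((x + h) mod n))"
    using n by (intro discrete_Crofton_sum[symmetric] D) auto
  finally show ?thesis by simp
qed

section \<open>Balanced cuts for even \<open>n\<close>\<close>

lemma card_balanced_arc_cut:
  assumes "n = 2 * m" "a < m"
  shows "card {x\<in>{..<n}. arc_cut a (a + m) x} = m" "card {x\<in>{..<n}. \<not> arc_cut a (a + m) x} = m"
proof -
  have eq: "{x\<in>{..<n}. arc_cut a (a + m) x} = {Suc a..a + m}"
    using assms by (auto simp: arc_cut_def)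
  then show "card {x\<in>{..<n}. arc_cut a (a + m) x} = m" by simp
  have "{x\<in>{..<n}. \<not> arc_cut a (a + m) x} = {..<n} - {x\<in>{..<n}. arc_cut a (a + m) x}" by auto
  also have "card \<dots> = n - m"
    using assms unfolding eq by (subst card_Diff_subset) auto
  finally show "card {x\<in>{..<n}. \<not> arc_cut a (a + m) x} = m" using assms by simp
qed

lemma crossings_balanced_shift:
  assumes n: "n = 2 * m" and a: "a < m"
  shows "crossings n (arc_cut a (a + m)) (\<lambda>x. x) (\<lambda>x. (x + (m - 1)) mod n) \<ge> 2 * real m - 2"
proof -
  \<comment> \<open>Within the arc \<open>{Suc a..a + m}\<close> a shift by \<open>m - 1\<close> can
    only join the first point to the last.\<close>
  have "{k. k < n \<and> arc_cut a (a + m) k \<and> arc_cut a (a + m) ((k + (m - 1)) mod n)} \<subseteq> {Suc a}"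
    using assms by (auto simp: arc_cut_def mod_less_double split: if_splits)
  from card_mono[OF _ this]
  have "card {k. k < n \<and> arc_cut a (a + m) k \<and> arc_cut a (a + m) ((k + (m - 1)) mod n)} \<le> 1"
    by simp
  then show ?thesis
    unfolding crossings_eq[OF bij_betw_id[unfolded id_def] bij_betw_add_mod]
      card_balanced_arc_cut[OF assms] by linarith
qed

text \<open>Both sides have \<open>m\<close> points, so \<open>crossings_eq\<close> may be applied
  to either: one edge inside either side already costs 2.\<close>

lemma crossings_balanced_le:
  assumes n: "n = 2 * m" and a: "a < m"
    and f: "bij_betw f {..<n} {..<n}" and g: "bij_betw g {..<n} {..<n}"
  shows "crossings n (arc_cut a (a + m)) f g \<le> 2 * real m - 2
    + 2 * of_bool (\<forall>k<n. arc_cut a (a + m) (f k) \<noteq> arc_cut a (a + m) (g k))"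
proof -
  let ?c = "arc_cut a (a + m)"
  have 1: "crossings n ?c f g = 2 * real m - 2 * real (card {k. k < n \<and> ?c (f k) \<and> ?c (g k)})"
    unfolding crossings_eq[OF f g] card_balanced_arc_cut[OF n a] ..
  have 2: "crossings n ?c f g = 2 * real m - 2 * real (card {k. k < n \<and> \<not> ?c (f k) \<and> \<not> ?c (g k)})"
    using crossings_eq[OF f g, of "\<lambda>x. \<not> ?c x"]
    unfolding crossings_compl card_balanced_arc_cut[OF n a] .
  show ?thesis
  proof (cases "\<forall>k<n. ?c (f k) \<noteq> ?c (g k)")
    case True
    then show ?thesis using 1 by simp
  next
    case False
    then obtain k where k: "k < n" "?c (f k) = ?c (g k)" by blast
    have fin: "finite {k. k < n \<and> Q k}" for Q :: "nat \<Rightarrow> bool" by simp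
    have ge1: "1 \<le> card {k. k < n \<and> Q k}" if "Q k" for Q
      using that k card_gt_0_iff[of "{k. k < n \<and> Q k}"] fin[of Q] by (auto simp: Suc_le_eq)
    show ?thesis
    proof (cases "?c (f k)")
      case True
      then show ?thesis using 1 False ge1[of "\<lambda>k. ?c (f k) \<and> ?c (g k)"] k by simp
    next
      case c: False
      then show ?thesis using 2 False ge1[of "\<lambda>k. \<not> ?c (f k) \<and> \<not> ?c (g k)"] k by simp
    qed
  qed
qed

lemma alternating_colour:
  assumes "\<forall>k<n. c (\<pi> k) \<noteq> c (\<pi> (Suc k mod n))" "k < n"
  shows "c (\<pi> k) \<longleftrightarrow> (c (\<pi> 0) \<noteq> odd k)"
  using assms(2)
proof (induction k)
  case (Suc k)
  then show ?case using assms(1)[rule_format, of k] by auto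
qed simp

text \<open>Alternation along the tour determines the 2-colouring up to swapping the
  colours.\<close>

lemma alternating_balanced_arc_cut_unique:
  assumes n: "n = 2 * m" and a: "a < m" and b: "b < m" and bij: "bij_betw \<pi> {..<n} {..<n}"
    and alt_a: "\<forall>k<n. arc_cut a (a + m) (\<pi> k) \<noteq> arc_cut a (a + m) (\<pi> (Suc k mod n))"
    and alt_b: "\<forall>k<n. arc_cut b (b + m) (\<pi> k) \<noteq> arc_cut b (b + m) (\<pi> (Suc k mod n))"
  shows "a = b"
proof -
  have surj: "\<exists>k<n. x = \<pi> k" if "x < n" for x
    using bij that by (auto simp: bij_betw_def image_iff set_eq_iff)
  have const: "(arc_cut a (a + m) x = arc_cut b (b + m) x)
      = (arc_cut a (a + m) (\<pi> 0) = arc_cut b (b + m) (\<pi> 0))" if "x < n" for x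
    using surj[OF that] alternating_colour[of n "arc_cut a (a + m)" \<pi>, OF alt_a]
      alternating_colour[of n "arc_cut b (b + m)" \<pi>, OF alt_b] by metis
  \<comment> \<open>Index \<open>0\<close> lies outside both arcs, which rules out the swap.\<close>
  have "arc_cut a (a + m) 0 = arc_cut b (b + m) 0" by (simp add: arc_cut_def)
  then have "arc_cut a (a + m) x = arc_cut b (b + m) x" if "x < n" for x
    using const[OF that] const[of 0] n a by simp
  from this[of "Suc a"] this[of "Suc b"] show ?thesis
    using n a b by (auto simp: arc_cut_def)
qed

lemma even_tour_bound:
  assumes D: "\<And>x y. D x y = D y x" "\<And>x. D x x = 0" "\<And>x. D x n = D x 0"
    and pos: "\<And>a b. a < n \<Longrightarrow> b < n \<Longrightarrow> a \<noteq> b \<Longrightarrow> 0 \<le> mixed_diff D a b"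
    and n: "n = 2 * m" and m: "m > 0" and bij: "bij_betw \<pi> {..<n} {..<n}"
    and G: "\<And>a. a < m \<Longrightarrow> mixed_diff D a (a + m) \<le> G"
  shows "(\<Sum>k<n. D (\<pi> k) (\<pi> (Suc k mod n))) \<le> (\<Sum>x<n. D x ((x + (m - 1)) mod n)) + G"
proof -
  let ?\<pi>' = "\<lambda>k. \<pi> (Suc k mod n)"
  define alt where "alt a b \<longleftrightarrow> (\<forall>k<n. arc_cut a b (\<pi> k) \<noteq> arc_cut a b (?\<pi>' k))" for a b
  \<comment> \<open>Marks the balanced cuts on which the tour alternates. Each appears in both
    orders with an excess of at most 2, so the total excess is at most \<open>4 * G\<close>,
    matching the factor 4 in \<open>discrete_Crofton_sum\<close>.\<close>
  define Q where "Q a b \<longleftrightarrow> (b = a + m \<or> a = b + m) \<and> alt a b" for a b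
  let ?X = "\<lambda>a b. crossings n (arc_cut a b) (\<lambda>x. x) (\<lambda>x. (x + (m - 1)) mod n)"
  have md_sym: "mixed_diff D a b = mixed_diff D b a" for a b
    using D(1) by (simp add: mixed_diff_def)
  have alt_sym: "alt a b = alt b a" for a b
    by (simp add: alt_def arc_cut_commute[of a b])
  have bij': "bij_betw ?\<pi>' {..<n} {..<n}"
    using bij_betw_trans[OF bij_betw_Suc_mod bij] by (simp add: o_def)
  have cross: "crossings n (arc_cut a b) \<pi> ?\<pi>' \<le> ?X a b + 2 * of_bool (Q a b)"
    if ab: "a < n" "b < n" for a b
  proof -
    consider "b = a + m" | "a = b + m" | "b \<noteq> a + m" "a \<noteq> b + m" by blast
    then show ?thesis
    proof cases
      case 1
      then show ?thesis
        using crossings_balanced_le[OF n _ bij bij', of a] crossings_balanced_shift[OF n, of a] ab n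
        by (simp add: Q_def alt_def)
    next
      case 2
      then show ?thesis
        using crossings_balanced_le[OF n _ bij bij', of b] crossings_balanced_shift[OF n, of b] ab n
        by (simp add: Q_def alt_def arc_cut_commute[of "b + m" b])
    next
      case 3
      then have "crossings n (arc_cut a b) \<pi> ?\<pi>' \<le> ?X a b"
        using ab n m by (intro crossings_le_shift bij bij') auto
      then show ?thesis by simp
    qed
  qed
  have "mixed_diff D 0 m \<ge> 0" using pos n m by simp
  then have G0: "G \<ge> 0" using G[of 0] m by simp
  have Qsum: "(\<Sum>a<n. \<Sum>b<n. mixed_diff D a b * of_bool (Q a b)) \<le> 2 * G"
  proof (cases "\<exists>a<m. alt a (a + m)")
    case True
    then obtain a0 where a0: "a0 < m" "alt a0 (a0 + m)" by blast
    define T where "T = {(a0, a0 + m), (a0 + m, a0)}"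
    have T: "(a, b) \<in> T" if abQ: "a < n" "b < n" "Q a b" for a b
    proof -
      consider "b = a + m" "a < m" "alt a (a + m)" | "a = b + m" "b < m" "alt b (b + m)"
        using abQ n by (auto simp: Q_def alt_sym[of "b + m" b])
      then show ?thesis
        using alternating_balanced_arc_cut_unique[OF n _ a0(1) bij] a0(2)
        unfolding T_def alt_def by cases blast+
    qed
    have "(\<Sum>a<n. \<Sum>b<n. mixed_diff D a b * of_bool (Q a b))
        = (\<Sum>z\<in>{..<n} \<times> {..<n}. mixed_diff D (fst z) (snd z) * of_bool (Q (fst z) (snd z)))"
      unfolding sum.cartesian_product by (rule sum.cong) (simp_all only: split_beta)
    also have "\<dots> = (\<Sum>z\<in>T. mixed_diff D (fst z) (snd z) * of_bool (Q (fst z) (snd z)))"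
    proof (intro sum.mono_neutral_right ballI)
      show "T \<subseteq> {..<n} \<times> {..<n}" using a0 n by (auto simp: T_def)
      fix z assume "z \<in> {..<n} \<times> {..<n} - T"
      then have "\<not> Q (fst z) (snd z)" using T[of "fst z" "snd z"] by auto
      then show "mixed_diff D (fst z) (snd z) * of_bool (Q (fst z) (snd z)) = 0" by simp
    qed simp
    also have "\<dots> \<le> (\<Sum>z\<in>T. mixed_diff D (fst z) (snd z))"
      using m a0 n pos[of a0 "a0 + m"] pos[of "a0 + m" a0]
      by (intro sum_mono) (auto simp: T_def)
    also have "\<dots> = mixed_diff D a0 (a0 + m) + mixed_diff D (a0 + m) a0"
      using m by (simp add: T_def)
    also have "\<dots> \<le> 2 * G" using G[OF a0(1)] md_sym[of "a0 + m" a0] by simp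
    finally show ?thesis .
  next
    case False
    then have "\<not> Q a b" if "a < n" "b < n" for a b
      using that n by (auto simp: Q_def alt_sym[of "b + m" b])
    then show ?thesis using G0 by (simp add: sum.neutral)
  qed
  have "4 * (\<Sum>k<n. D (\<pi> k) (?\<pi>' k))
      = (\<Sum>a<n. \<Sum>b<n. mixed_diff D a b * crossings n (arc_cut a b) \<pi> ?\<pi>')"
    using bij bij' by (intro discrete_Crofton_sum D) (auto dest: bij_betwE)
  also have "\<dots> \<le> (\<Sum>a<n. \<Sum>b<n. mixed_diff D a b * ?X a b + 2 * (mixed_diff D a b * of_bool (Q a b)))"
  proof (intro sum_mono)
    fix a b assume "a \<in> {..<n}" "b \<in> {..<n}"
    then have ab: "a < n" "b < n" by auto
    show "mixed_diff D a b * crossings n (arc_cut a b) \<pi> ?\<pi>'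
      \<le> mixed_diff D a b * ?X a b + 2 * (mixed_diff D a b * of_bool (Q a b))"
    proof (cases "a = b")
      case True
      then show ?thesis using m by (simp add: crossings_def arc_cut_def Q_def)
    next
      case False
      then show ?thesis
        using mult_left_mono[OF cross[OF ab] pos[OF ab False]] by (simp only: distrib_left mult.left_commute)
    qed
  qed
  also have "\<dots> = 4 * (\<Sum>x<n. D x ((x + (m - 1)) mod n))
      + 2 * (\<Sum>a<n. \<Sum>b<n. mixed_diff D a b * of_bool (Q a b))"
    unfolding sum.distrib sum_distrib_left[symmetric]
    using n m by (subst discrete_Crofton_sum[OF D]) auto
  finally show ?thesis using Qsum by simp
qed

section \<open>The tours returned by CROSS'\<close>

text \<open>Modulo \<open>n = 2 (l + 1)\<close>, the tour advances from \<open>i\<close> by \<open>l\<close> steps of length \<open>l\<close>, jumps to the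
  antipode and returns along the antipodal points. The jump happens at \<open>i + l\<^sup>2\<close>, which is
  congruent to \<open>i + 1\<close> or to its antipode according to the parity of \<open>l\<close>; hence this one formula
  covers both the case where the initial 2-factor is a single cycle and the case of two cycles.\<close>
definition zigzag :: "nat \<Rightarrow> nat \<Rightarrow> nat \<Rightarrow> nat" where
  "zigzag l i k = (if k \<le> l then i + k * l else i + (2 * l + 1 - k) * l + Suc l) mod (2 * Suc l)"

lemma int_dvd_abs_less: "\<lbrakk>(d::int) dvd x; \<bar>x\<bar> < d\<rbrakk> \<Longrightarrow> x = 0"
  using zdvd_not_zless[of "\<bar>x\<bar>" d] by auto

lemma mod_eq_int_dvd: "(x::nat) mod n = y mod n \<Longrightarrow> int n dvd int x - int y"
  by (metis mod_eq_dvd_iff of_nat_mod)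

text \<open>Since \<open>l\<close> is \<open>-1\<close> modulo \<open>Suc l\<close>, the residue
  modulo \<open>Suc l\<close> determines \<open>k\<close>; the remaining multiple of
  \<open>Suc l\<close>, taken modulo 2, determines \<open>e\<close>.\<close>

lemma zigzag_coords_unique:
  assumes eq: "(i + k * l + e * Suc l) mod (2 * Suc l) = (i + k' * l + e' * Suc l) mod (2 * Suc l)"
    and le: "k \<le> l" "k' \<le> l" "e \<le> 1" "e' \<le> 1"
  shows "k = k'" "e = e'"
proof -
  define M where "M = int (Suc l)"
  have dvd: "2 * M dvd (int k - int k') * (M - 1) + (int e - int e') * M"
    using mod_eq_int_dvd[OF eq] by (simp add: M_def algebra_simps)
  then have "M dvd (int k - int k') * (M - 1) + (int e - int e') * M"
    by (rule dvd_mult_right[of 2])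
  moreover have "(int k - int k') * (M - 1) + (int e - int e') * M
      = M * (int k - int k' + int e - int e') - (int k - int k')"
    by (simp add: algebra_simps)
  ultimately have "M dvd int k - int k'" by (metis dvd_diff_right_iff dvd_triv_left)
  then have "int k - int k' = 0"
    by (rule int_dvd_abs_less) (use le in \<open>auto simp: M_def\<close>)
  then show "k = k'" by simp
  then have "2 * M dvd (int e - int e') * M" using dvd by simp
  moreover have "M \<noteq> 0" by (simp add: M_def)
  ultimately have "2 dvd int e - int e'" using dvd_mult_cancel_right by blast
  then show "e = e'" using int_dvd_abs_less[of 2 "int e - int e'"] le by auto
qed

lemma bij_betw_zigzag: "bij_betw (zigzag l i) {..<2 * Suc l} {..<2 * Suc l}"
proof -
  define K where "K k = (if k \<le> l then k else 2 * l + 1 - k)" for k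
  define e where "e k = (of_bool (\<not> k \<le> l) :: nat)" for k
  have zz: "zigzag l i k = (i + K k * l + e k * Suc l) mod (2 * Suc l)" for k
    by (simp add: zigzag_def K_def e_def)
  have "inj_on (zigzag l i) {..<2 * Suc l}"
  proof (rule inj_onI)
    fix x y assume xy: "x \<in> {..<2 * Suc l}" "y \<in> {..<2 * Suc l}" "zigzag l i x = zigzag l i y"
    have "K k \<le> l" "e k \<le> 1" for k by (auto simp: K_def e_def)
    then have "K x = K y" "e x = e y"
      using zigzag_coords_unique[OF xy(3)[unfolded zz]] by blast+
    then show "x = y" using xy(1,2) by (auto simp: K_def e_def split: if_splits)
  qed
  moreover have "zigzag l i ` {..<2 * Suc l} \<subseteq> {..<2 * Suc l}" by (auto simp: zigzag_def)
  ultimately show ?thesis by (simp add: bij_betw_def endo_inj_surj)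
qed

text \<open>From \<open>l * l = (l - 1) * Suc l + 1\<close>, the parity of \<open>l - 1\<close>
  decides between \<open>i + 1\<close> and its antipode.\<close>

lemma zigzag_turn:
  fixes l i :: nat
  assumes "l > 0"
  defines "n \<equiv> 2 * Suc l"
  shows "(zigzag l i l = (i + 1) mod n \<and> zigzag l i (Suc l) = (i + 1 + Suc l) mod n) \<or>
    (zigzag l i l = (i + 1 + Suc l) mod n \<and> zigzag l i (Suc l) = (i + 1) mod n)"
proof (cases "even l")
  case True
  then obtain r where r: "l = 2 * Suc r" using assms(1) by (metis dvdE gr0_implies_Suc mult_0_right not_gr_zero)
  have "i + l * l = i + 1 + Suc l + r * n" by (simp add: r n_def algebra_simps)
  moreover have "i + l * l + Suc l = i + 1 + Suc r * n" by (simp add: r n_def algebra_simps)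
  ultimately have "(i + l * l) mod n = (i + 1 + Suc l) mod n" "(i + l * l + Suc l) mod n = (i + 1) mod n"
    by (metis mod_mult_self1 mult.commute)+
  then show ?thesis unfolding zigzag_def n_def[symmetric] by simp
next
  case False
  then obtain r where r: "l = 2 * r + 1" by (auto elim: oddE)
  have "i + l * l = i + 1 + r * n" by (simp add: r n_def algebra_simps)
  moreover have "i + l * l + Suc l = i + 1 + Suc l + r * n" by (simp add: r n_def algebra_simps)
  ultimately have "(i + l * l) mod n = (i + 1) mod n" "(i + l * l + Suc l) mod n = (i + 1 + Suc l) mod n"
    by (metis mod_mult_self1 mult.commute)+
  then show ?thesis unfolding zigzag_def n_def[symmetric] by simp
qed

section \<open>Edges and length of the zigzag tour\<close>

lemma pm_mod: "pm n p (x mod n) = pm n p x"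
  by (simp add: pm_def)

lemma pm_less: "x < n \<Longrightarrow> pm n p x = p x"
  by (simp add: pm_def)

lemma pm_eq_iff:
  assumes "inj_on p {..<n}" "n > 0"
  shows "pm n p x = pm n p y \<longleftrightarrow> x mod n = y mod n"
  using assms by (auto simp: pm_def inj_on_eq_iff)

text \<open>On the way back the edges are traversed against the shift, so there the earlier point is
  the shift of the later one.\<close>

lemma zigzag_steps:
  fixes l i :: nat and p :: "nat \<Rightarrow> complex"
  defines "n \<equiv> 2 * Suc l" and "\<sigma> \<equiv> zigzag l i"
  shows "k < l \<Longrightarrow> pm n p (\<sigma> (Suc k)) = pm n p (\<sigma> k + l)"
    and "Suc l \<le> k \<Longrightarrow> k < 2 * l + 1 \<Longrightarrow> pm n p (\<sigma> k) = pm n p (\<sigma> (Suc k) + l)"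
    and "pm n p (\<sigma> 0) = pm n p i" "pm n p (\<sigma> (2 * l + 1)) = pm n p (i + Suc l)"
proof -
  have eqI: "pm n p x = pm n p y" if "x mod n = y mod n" for x y
    using that by (simp add: pm_def)
  show "pm n p (\<sigma> (Suc k)) = pm n p (\<sigma> k + l)" if "k < l"
    using that unfolding \<sigma>_def zigzag_def n_def[symmetric]
    by (intro eqI) (simp add: mod_simps algebra_simps)
  show "pm n p (\<sigma> k) = pm n p (\<sigma> (Suc k) + l)" if k: "Suc l \<le> k" "k < 2 * l + 1"
  proof -
    have "2 * l + 1 - k = Suc (2 * l + 1 - Suc k)" using k by simp
    then have "(2 * l + 1 - k) * l = (2 * l + 1 - Suc k) * l + l" by simp
    then have "i + (2 * l + 1 - k) * l + Suc l = i + (2 * l + 1 - Suc k) * l + Suc l + l" by simp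
    then show ?thesis
      using k unfolding \<sigma>_def zigzag_def n_def[symmetric]
      by (intro eqI) (simp add: mod_simps algebra_simps)
  qed
  show "pm n p (\<sigma> 0) = pm n p i" "pm n p (\<sigma> (2 * l + 1)) = pm n p (i + Suc l)"
    unfolding \<sigma>_def zigzag_def n_def[symmetric] by (intro eqI; simp)+
qed

text \<open>Any other coincidence would force \<open>n\<close> to divide \<open>2 * l\<close>, but
  \<open>0 < 2 * l < n\<close>.\<close>

lemma shift_edge_inj:
  assumes p: "inj_on p {..<n}" and l: "l > 0" and n: "n = 2 * Suc l"
    and xy: "x < n" "y < n"
    and eq: "{pm n p x, pm n p (x + l)} = {pm n p y, pm n p (y + l)}"
  shows "x = y"
proof (cases "pm n p x = pm n p y")
  case True
  then show ?thesis using xy pm_eq_iff[OF p, of x y] by simp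
next
  case False
  then have "pm n p x = pm n p (y + l)" "pm n p y = pm n p (x + l)" using eq by (auto simp: doubleton_eq_iff)
  then have "x = (y + l) mod n" "y = (x + l) mod n" using xy pm_eq_iff[OF p, of x y] pm_eq_iff[OF p, of x "y + l"] pm_eq_iff[OF p, of y "x + l"] by simp_all
  then show ?thesis using xy n l by (auto simp: mod_less_double split: if_splits)
qed

text \<open>The tour uses every shift edge except those starting at \<open>i + 1\<close> and its
  antipode, which are the two edges that the exchange deletes. Its jump and its closing edge are the
  two inserted ones.\<close>

lemma zigzag_tour:
  fixes p :: "nat \<Rightarrow> complex" and i :: nat
  assumes p: "inj_on p {..<n}" and l: "l > 0" and n: "n = 2 * Suc l"
  defines "s \<equiv> \<lambda>k. p (zigzag l i k)"
  shows "tour_edges n s = cross_even_exchange n p i"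
    and "tour_length n s = (\<Sum>x<n. dist (pm n p x) (pm n p (x + l))) + cross_gain n p i"
proof -
  let ?q = "pm n p"
  define \<sigma> where "\<sigma> = zigzag l i"
  define e where "e x = {?q x, ?q (x + l)}" for x
  define H where "H x = dist (?q x) (?q (x + l))" for x
  have bij: "bij_betw \<sigma> {..<n} {..<n}" using bij_betw_zigzag[of l i] n by (simp add: \<sigma>_def)
  have \<sigma>_less: "\<sigma> k < n" for k using n by (simp add: \<sigma>_def zigzag_def)
  have s: "s k = ?q (\<sigma> k)" for k using \<sigma>_less by (simp add: s_def \<sigma>_def pm_less)
  note steps = zigzag_steps[where l = l and i = i and p = p, folded n \<sigma>_def]
  have eH_mod: "e (x mod n) = e x" "H (x mod n) = H x" for x
    unfolding e_def H_def by (simp_all add: pm_def mod_simps)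
  have n2: "n div 2 = Suc l" using n by simp
  have per: "?q (x + n) = ?q x" for x by (simp add: pm_def)
  have "i + 1 + Suc l + l = i + n" using n by simp
  then have wrap: "?q (i + 1 + Suc l + l) = ?q i" "?q (i + 1 + l) = ?q (i + Suc l)"
    using per[of i] by (simp_all only: add_Suc_right add_Suc add_0_right One_nat_def)
  have turn: "(\<sigma> l = (i + 1) mod n \<and> \<sigma> (Suc l) = (i + 1 + Suc l) mod n) \<or>
    (\<sigma> l = (i + 1 + Suc l) mod n \<and> \<sigma> (Suc l) = (i + 1) mod n)"
    using zigzag_turn[OF l, of i] by (simp add: n \<sigma>_def)
  have next1: "s (Suc k mod n) = ?q (\<sigma> k + l)" if "k < l" for k
    using steps(1)[OF that] that n by (simp add: s)
  have next2: "s k = ?q (\<sigma> (Suc k) + l)" "s (Suc k mod n) = ?q (\<sigma> (Suc k))"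
    if "Suc l \<le> k" "k < 2 * l + 1" for k
    using steps(2)[OF that] that n by (simp_all add: s)
  have next3: "{s l, s (Suc l mod n)} = {?q (i + 1), ?q (i + 1 + Suc l)}"
    "dist (s l) (s (Suc l mod n)) = dist (?q (i + 1)) (?q (i + 1 + Suc l))"
    using turn n by (auto simp: s pm_mod dist_commute)
  have next4: "s (2 * l + 1) = ?q (i + Suc l)" "s (Suc (2 * l + 1) mod n) = ?q i"
    using steps(3,4) n by (simp_all add: s)
  \<comment> \<open>\<open>split\<close> follows the tour: way out, jump, way back, closing edge.
    \<open>split'\<close> indexes shift edges by their starting point, which on the way back is the
    later position's successor in the count; hence the offset by one.\<close>
  have split: "{..<n} = {..<l} \<union> {l} \<union> {Suc l..<2 * l + 1} \<union> {2 * l + 1}"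
    using n by auto
  have split': "{..<n} = {..<l} \<union> {l} \<union> {Suc l} \<union> {Suc (Suc l)..<Suc (2 * l + 1)}"
    using n by auto

  have removed: "{e (\<sigma> l), e (\<sigma> (Suc l))} = {{?q i, ?q (i + Suc l + 1)}, {?q (i + 1), ?q (i + Suc l)}}"
  proof -
    have "e (i + 1) = {?q (i + 1), ?q (i + Suc l)}" "e (i + 1 + Suc l) = {?q i, ?q (i + Suc l + 1)}"
      unfolding e_def wrap by (simp_all add: insert_commute)
    then show ?thesis
      using turn by (elim disjE conjE) (simp_all only: eH_mod insert_commute)
  qed
  \<comment> \<open>Injectivity ensures that deleting two edges from the edge set deletes just two
    positions.\<close>
  have inj_e: "inj_on (\<lambda>k. e (\<sigma> k)) {..<n}"
    using bij shift_edge_inj[OF p l n] \<sigma>_less by (auto simp: inj_on_def e_def bij_betw_def)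
  have init: "cross_even_init n p = (\<lambda>k. e (\<sigma> k)) ` {..<n}"
  proof -
    have "cross_even_init n p = e ` {..<n}"
      unfolding cross_even_init_def e_def n2 by auto
    also have "\<dots> = e ` (\<sigma> ` {..<n})" using bij by (simp add: bij_betw_def)
    finally show ?thesis by (simp add: image_image)
  qed
  have kept: "cross_even_init n p - {e (\<sigma> l), e (\<sigma> (Suc l))}
      = (\<lambda>k. e (\<sigma> k)) ` ({..<l} \<union> {Suc (Suc l)..<Suc (2 * l + 1)})"
  proof -
    have "cross_even_init n p - {e (\<sigma> l), e (\<sigma> (Suc l))}
        = (\<lambda>k. e (\<sigma> k)) ` {..<n} - (\<lambda>k. e (\<sigma> k)) ` {l, Suc l}" by (simp add: init)
    also have "\<dots> = (\<lambda>k. e (\<sigma> k)) ` ({..<n} - {l, Suc l})"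
      using n by (intro inj_on_image_set_diff[symmetric, OF inj_e]) auto
    also have "{..<n} - {l, Suc l} = {..<l} \<union> {Suc (Suc l)..<Suc (2 * l + 1)}"
      using n by auto
    finally show ?thesis .
  qed
  have "tour_edges n s = (\<lambda>k. {s k, s (Suc k mod n)}) ` {..<n}"
    by (auto simp: tour_edges_def)
  also have "\<dots> = (\<lambda>k. {s k, s (Suc k mod n)}) ` {..<l} \<union> {{s l, s (Suc l mod n)}}
      \<union> (\<lambda>k. {s k, s (Suc k mod n)}) ` {Suc l..<2 * l + 1}
      \<union> {{s (2 * l + 1), s (Suc (2 * l + 1) mod n)}}"
    unfolding split image_Un by simp
  also have "(\<lambda>k. {s k, s (Suc k mod n)}) ` {..<l} = (\<lambda>k. e (\<sigma> k)) ` {..<l}"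
    by (intro image_cong refl) (simp only: lessThan_iff next1 e_def, simp only: s)
  also have "(\<lambda>k. {s k, s (Suc k mod n)}) ` {Suc l..<2 * l + 1}
      = (\<lambda>k. e (\<sigma> (Suc k))) ` {Suc l..<2 * l + 1}"
    by (intro image_cong refl) (simp only: atLeastLessThan_iff next2 e_def insert_commute)
  also have "\<dots> = (\<lambda>k. e (\<sigma> k)) ` {Suc (Suc l)..<Suc (2 * l + 1)}"
    unfolding image_Suc_atLeastLessThan[symmetric] image_image ..
  finally have "tour_edges n s = (cross_even_init n p - {e (\<sigma> l), e (\<sigma> (Suc l))})
      \<union> {{?q i, ?q (i + Suc l)}, {?q (i + 1), ?q (i + 1 + Suc l)}}"
    unfolding kept next3 next4 image_Un by blast
  then show "tour_edges n s = cross_even_exchange n p i"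
    unfolding cross_even_exchange_def n2 removed .

  have H_removed: "H (\<sigma> l) + H (\<sigma> (Suc l)) = dist (?q i) (?q (i + Suc l + 1)) + dist (?q (i + 1)) (?q (i + Suc l))"
  proof -
    have "H (i + 1) = dist (?q (i + 1)) (?q (i + Suc l))"
      "H (i + 1 + Suc l) = dist (?q i) (?q (i + Suc l + 1))"
      unfolding H_def wrap by (simp_all add: dist_commute)
    then show ?thesis
      using turn by (elim disjE conjE) (simp_all only: eH_mod add.commute)
  qed
  have "tour_length n s = (\<Sum>k<l. H (\<sigma> k)) + dist (?q (i + 1)) (?q (i + 1 + Suc l))
      + (\<Sum>k\<in>{Suc l..<2 * l + 1}. H (\<sigma> (Suc k))) + dist (?q i) (?q (i + Suc l))"
  proof -
    have "tour_length n s = (\<Sum>k<l. dist (s k) (s (Suc k mod n))) + dist (s l) (s (Suc l mod n))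
      + (\<Sum>k\<in>{Suc l..<2 * l + 1}. dist (s k) (s (Suc k mod n))) + dist (s (2 * l + 1)) (s (Suc (2 * l + 1) mod n))"
      unfolding tour_length_def split
      by ((subst sum.union_disjoint; (auto; fail)?)+; simp?)
    moreover have "(\<Sum>k<l. dist (s k) (s (Suc k mod n))) = (\<Sum>k<l. H (\<sigma> k))"
      by (intro sum.cong refl) (simp only: lessThan_iff next1 H_def, simp only: s)
    moreover have "(\<Sum>k\<in>{Suc l..<2 * l + 1}. dist (s k) (s (Suc k mod n))) = (\<Sum>k\<in>{Suc l..<2 * l + 1}. H (\<sigma> (Suc k)))"
      by (intro sum.cong refl) (simp only: atLeastLessThan_iff next2 H_def dist_commute)
    ultimately show ?thesis unfolding next3 next4 by (simp add: dist_commute)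
  qed
  also have "(\<Sum>k\<in>{Suc l..<2 * l + 1}. H (\<sigma> (Suc k))) = (\<Sum>k\<in>{Suc (Suc l)..<Suc (2 * l + 1)}. H (\<sigma> k))"
    by (rule sum.shift_bounds_Suc_ivl[symmetric])
  finally have len: "tour_length n s = (\<Sum>k<l. H (\<sigma> k)) + dist (?q (i + 1)) (?q (i + 1 + Suc l))
      + (\<Sum>k\<in>{Suc (Suc l)..<Suc (2 * l + 1)}. H (\<sigma> k)) + dist (?q i) (?q (i + Suc l))" .
  have "(\<Sum>x<n. H x) = (\<Sum>k<n. H (\<sigma> k))" by (rule sum.reindex_bij_betw[OF bij, symmetric])
  also have "\<dots> = (\<Sum>k<l. H (\<sigma> k)) + H (\<sigma> l) + H (\<sigma> (Suc l)) + (\<Sum>k\<in>{Suc (Suc l)..<Suc (2 * l + 1)}. H (\<sigma> k))"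
    unfolding split' by ((subst sum.union_disjoint; (auto; fail)?)+; simp?)
  finally have sumH: "(\<Sum>x<n. H x) = \<dots>" .
  show "tour_length n s = (\<Sum>x<n. dist (?q x) (?q (x + l))) + cross_gain n p i"
    using len sumH H_removed unfolding H_def[symmetric] cross_gain_def n2 by simp
qed

section \<open>The star polygon for odd \<open>n\<close>\<close>

lemma bij_betw_mult_mod:
  assumes "coprime h n" "n > 0"
  shows "bij_betw (\<lambda>k. k * h mod n) {..<n} {..<n::nat}"
proof -
  have "inj_on (\<lambda>k. k * h mod n) {..<n}"
  proof (rule inj_onI)
    fix x y assume xy: "x \<in> {..<n}" "y \<in> {..<n}" "x * h mod n = y * h mod n"
    have "int n dvd (int x - int y) * int h"
      using mod_eq_int_dvd[OF xy(3)] by (simp add: algebra_simps)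
    then have "int n dvd int x - int y"
      using assms(1) by (simp add: coprime_dvd_mult_left_iff coprime_commute)
    then have "int x - int y = 0" by (rule int_dvd_abs_less) (use xy in auto)
    then show "x = y" by simp
  qed
  moreover have "(\<lambda>k. k * h mod n) ` {..<n} \<subseteq> {..<n}" using assms by auto
  ultimately show ?thesis by (simp add: bij_betw_def endo_inj_surj)
qed

text \<open>As \<open>h\<close> is coprime to \<open>2 * h + 1\<close>, steps of length
  \<open>h\<close> visit every vertex before closing up.\<close>

lemma star_tour:
  fixes p :: "nat \<Rightarrow> complex" and h :: nat
  assumes n: "n = 2 * h + 1"
  defines "s \<equiv> \<lambda>k. p (k * h mod n)"
  shows "tour_edges n s = cross_odd n p"
    and "tour_length n s = (\<Sum>x<n. dist (pm n p x) (pm n p (x + h)))"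
    and "bij_betw (\<lambda>k. k * h mod n) {..<n} {..<n}"
proof -
  let ?\<sigma> = "\<lambda>k. k * h mod n"
  have "coprime h (2 * h + 1)"
    by (rule coprimeI) (metis dvd_add_right_iff dvd_mult)
  then show bij: "bij_betw ?\<sigma> {..<n} {..<n}" using n by (intro bij_betw_mult_mod) auto
  have s: "s k = pm n p (?\<sigma> k)" "s (Suc k mod n) = pm n p (?\<sigma> k + h)" for k
    by (simp_all add: s_def pm_def mod_simps add.commute)
  have h: "(n - 1) div 2 = h" using n by simp
  have "tour_edges n s = (\<lambda>x. {pm n p x, pm n p (x + h)}) ` (?\<sigma> ` {..<n})"
    unfolding image_image s[symmetric] by (auto simp: tour_edges_def)
  also have "?\<sigma> ` {..<n} = {..<n}" using bij by (simp add: bij_betw_def)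
  finally show "tour_edges n s = cross_odd n p" unfolding cross_odd_def h by auto
  show "tour_length n s = (\<Sum>x<n. dist (pm n p x) (pm n p (x + h)))"
    using sum.reindex_bij_betw[OF bij, of "\<lambda>x. dist (pm n p x) (pm n p (x + h))"]
    by (simp add: tour_length_def s[symmetric])
qed

lemma tour_length_reindex:
  assumes p: "bij_betw p {0..<n} P" and t: "bij_betw t {0..<n} P"
  obtains \<pi> where "bij_betw \<pi> {..<n} {..<n}"
    "tour_length n t = (\<Sum>k<n. dist (pm n p (\<pi> k)) (pm n p (\<pi> (Suc k mod n))))"
proof
  let ?\<pi> = "inv_into {0..<n} p \<circ> t"
  show bij: "bij_betw ?\<pi> {..<n} {..<n}"
    using bij_betw_trans[OF t bij_betw_inv_into[OF p]] by (simp add: lessThan_atLeast0)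
  have "pm n p (?\<pi> k) = t k" if "k < n" for k
  proof -
    have "?\<pi> k < n" using bij that by (auto dest: bij_betwE)
    moreover have "t k \<in> P" using t that by (auto dest: bij_betwE)
    ultimately show ?thesis using bij_betw_inv_into_right[OF p] by (simp add: pm_less)
  qed
  then show "tour_length n t = (\<Sum>k<n. dist (pm n p (?\<pi> k)) (pm n p (?\<pi> (Suc k mod n))))"
    unfolding tour_length_def by (intro sum.cong refl) auto
qed

theorem theorem5:
  fixes P :: "complex set" and n :: nat and c :: complex
    and p :: "nat \<Rightarrow> complex" and E :: "complex set set"
  assumes "finite P" and "card P = n" and "n \<ge> 3"
    and "convex_position P"
    and "c \<in> interior (convex hull P)"
    and "angularly_sorted c P n p"
    and "cross'_output n p E"
  shows "\<exists>s. bij_betw s {0..<n} P \<and> tour_edges n s = E \<and>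
           (\<forall>t. bij_betw t {0..<n} P \<longrightarrow> tour_length n t \<le> tour_length n s)"
proof -
  let ?D = "\<lambda>x y. dist (pm n p x) (pm n p y)"
  have p: "bij_betw p {0..<n} P" using assms(6) by (simp add: angularly_sorted_def)
  have inj: "inj_on p {..<n}" using p by (simp add: bij_betw_def lessThan_atLeast0)
  have D: "?D x y = ?D y x" "?D x x = 0" "?D x n = ?D x 0" for x y
    by (simp_all add: dist_commute pm_def)
  note pos = mixed_diff_dist_nonneg[OF assms(1,4,5,6)]
  have bij_comp: "bij_betw (\<lambda>k. p (\<sigma> k)) {0..<n} P" if "bij_betw \<sigma> {..<n} {..<n}" for \<sigma>
    using bij_betw_trans[OF that[unfolded lessThan_atLeast0] p] by (simp add: o_def)
  show ?thesis
  proof (cases "even n")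
    case False
    then obtain h where n: "n = 2 * h + 1" by (auto elim: oddE)
    let ?s = "\<lambda>k. p (k * h mod n)"
    have "tour_length n t \<le> tour_length n ?s" if "bij_betw t {0..<n} P" for t
    proof -
      from tour_length_reindex[OF p that] obtain \<pi> where
        "bij_betw \<pi> {..<n} {..<n}" "tour_length n t = (\<Sum>k<n. ?D (\<pi> k) (\<pi> (Suc k mod n)))" by blast
      then show ?thesis
        using odd_tour_bound[of ?D n h \<pi>, OF D pos n] star_tour(2)[OF n, of p] by (simp add: pm_mod)
    qed
    moreover have "E = cross_odd n p" using assms(7) False by (simp add: cross'_output_def)
    ultimately show ?thesis
      using star_tour(1)[OF n, of p] bij_comp[OF star_tour(3)[OF n]] by blast
  next
    case True
    then obtain m where "n = 2 * m" by blast
    moreover define l where "l = m - 1"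
    ultimately have n: "n = 2 * Suc l" and l: "l > 0" using assms(3) by auto
    obtain i where i: "cross_gain n p i = (MAX j\<in>{0..<n}. cross_gain n p j)"
      and E: "E = cross_even_exchange n p i"
      using assms(7) True by (auto simp: cross'_output_def)
    \<comment> \<open>The indices below \<open>Suc l\<close> represent each balanced cut once, so
      the maximum gain serves as the bound \<open>G\<close> in
      \<open>even_tour_bound\<close>.\<close>
    have gain: "mixed_diff ?D a (a + Suc l) \<le> cross_gain n p i" if "a < Suc l" for a
    proof -
      have "mixed_diff ?D a (a + Suc l) = cross_gain n p a"
        by (simp add: mixed_diff_def cross_gain_def n)
      also have "\<dots> \<le> cross_gain n p i"
        unfolding i using that n by (intro Max_ge) auto
      finally show ?thesis .
    qed
    let ?s = "\<lambda>k. p (zigzag l i k)"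
    have "tour_length n t \<le> tour_length n ?s" if "bij_betw t {0..<n} P" for t
    proof -
      from tour_length_reindex[OF p that] obtain \<pi> where
        "bij_betw \<pi> {..<n} {..<n}" "tour_length n t = (\<Sum>k<n. ?D (\<pi> k) (\<pi> (Suc k mod n)))" by blast
      then show ?thesis
        using even_tour_bound[of ?D n "Suc l" \<pi> "cross_gain n p i", OF D pos n _ _ gain]
          zigzag_tour(2)[OF inj l n, of i] by (simp add: pm_mod)
    qed
    then show ?thesis
      using zigzag_tour(1)[OF inj l n, of i] bij_comp[of "zigzag l i"] bij_betw_zigzag[of l i] E n
      by blast
  qed
qed

end
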